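(* For every integer $n \geq 2$, every real $\rho \in (0,1)$, every operator $\Gamma \in \{\widetilde{\mathrm{LS}}, \mathrm{LS}_+, \mathrm{SA}, \mathrm{SA}_+\}$, and every $k \in \{0,1,2,\ldots,n\}$, the polytope $P_{n,\rho} := \{x \in [0,1]^n : \sum_{i=1}^n x_i \leq n-\rho\}$ satisfies $$\gamma_{\bar{e}}\big(\Gamma^k(P_{n,\rho})\big) = 1 + \frac{(n-k)(1-\rho)}{(n-1)(n-k+k\rho)},$$ where $\bar{e} \in \mathbb{R}^n$ is the all-ones vector.
   Context: Integrality gap. For a compact convex set $P \subseteq [0,1]^n$ with integer hull $P_I := \mathrm{conv}(P\cap\{0,1\}^n) \neq \emptyset$ and $c \in \mathbb{R}^n$, $\gamma_c(P) := \dfrac{\max\{c^\top x : x \in P\}}{\max\{c^\top x : x \in P_I\}}$. Notation. $[n] := \{1,\ldots,n\}$. $K(P) := \{ (\lambda, \lambda x) \in \mathbb{R}^{n+1} : \lambda \geq 0,\ x \in P\}$ (the extra coordinate is indexed by $0$). Let $\mathcal{F} := \{0,1\}^n$. For $S \subseteq [n]$ and $t \in \{0,1\}$, let $S|_t := \{x \in \mathcal{F} : x_i = t \ \forall i \in S\}$ (so $\emptyset|_0=\emptyset|_1=\mathcal{F}$), and write $i|_t$ for $\{i\}|_t$. For an integer $\ell\ge 0$, $\mathcal{A}_\ell := \{S|_1 \cap T|_0 : S,T \subseteq [n],\ S \cap T = \emptyset,\ |S|+|T| \leq \ell\}$ and $\mathcal{A}_\ell^+ := \{S|_1 : S \subseteq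 [n],\ |S| \leq \ell\}$. For a vector $y$ indexed by a family containing $\mathcal{F}$ and all $i|_1$, $\hat{x}(y) := (y_{\mathcal{F}}, y_{1|_1}, \ldots, y_{n|_1})^\top$. For a matrix $Y$, $Y e_\alpha$ denotes its column indexed by $\alpha$. Operators. For all of them $\Gamma^0(P) := P$. Let $k \geq 1$. $\widetilde{\mathrm{LS}}$: $\widetilde{\mathrm{LS}}^k(P) := \bigcap_{S \subseteq [n],\,|S|=k} \mathrm{conv}\{x \in P : x_i \in \{0,1\}\ \forall i \in S\}$ for $k\in[n]$. $\mathrm{SA}_+$: let $\widehat{\mathrm{SA}}_+^k(P)$ be the set of real symmetric positive semidefinite matrices $Y$ indexed by $\mathcal{A}_k$ such that (1) $Y[\mathcal{F},\mathcal{F}] = 1$; (2) for every $\alpha \in \mathcal{A}_k$: $\hat{x}(Y e_\alpha) \in K(P)$ and $Y e_\alpha \geq 0$; (3) for every $S|_1 \cap T|_0 \in \mathcal{A}_{k-1}$ (with $S\cap T=\emptyset$, $|S|+|T|\le k-1$) and every $j \in [n]\setminus(S \cup T)$: $Y e_{S|_1 \cap T|_0 \cap j|_1} + Y e_{S|_1 \cap T|_0 \cap j|_0} = Y e_{S|_1 \cap T|_0}$; (4) for all $\alpha,\beta \in \mathcal{A}_k$ with $\alpha \cap \beta = \emptyset$: $Y[\alpha,\beta] = 0$; (5) for all $\alpha_1,\alpha_2,\beta_1,\beta_2 \in \mathcal{A}_k$ with $\alpha_1 \cap \beta_1 = \alpha_2 \cap \beta_2$: $Y[\alpha_1,\beta_1]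 = Y[\alpha_2,\beta_2]$. Then $\mathrm{SA}_+^k(P) := \{x \in \mathbb{R}^n : \exists\, Y \in \widehat{\mathrm{SA}}_+^k(P),\ \hat{x}(Y e_{\mathcal{F}}) = (1,x)^\top\}$. $\mathrm{LS}_+$ (Lov\'asz--Schrijver): $\mathrm{LS}_+(P) := \mathrm{SA}_+^1(P)$, and $\mathrm{LS}_+^k$ denotes $k$ iterated applications, $\mathrm{LS}_+^k(P) := \mathrm{LS}_+(\mathrm{LS}_+^{k-1}(P))$. $\mathrm{SA}$ (Sherali--Adams): $\mathrm{SA}^k(P)$ is the set of $x \in \mathbb{R}^n$ for which there is a real matrix $Y$ with rows indexed by $\mathcal{A}_1^+$ and columns indexed by $\mathcal{A}_k$ such that $\hat{x}(Ye_{\mathcal{F}}) = (1,x)^\top$; $Y[\mathcal{F},\mathcal{F}]=1$; $\hat{x}(Ye_\alpha) \in K(P)$ for all $\alpha \in \mathcal{A}_k$; the column identity in (3) above holds; $Y[\alpha,\beta]=0$ for all $\alpha \in \mathcal{A}_1^+$, $\beta \in \mathcal{A}_k$ with $\alpha\cap\beta=\emptyset$; and $Y[\alpha_1,\beta_1]=Y[\alpha_2,\beta_2]$ for all $\alpha_1,\alpha_2 \in \mathcal{A}_1^+$, $\beta_1,\beta_2 \in \mathcal{A}_k$ with $\alpha_1\cap\beta_1 = \alpha_2\cap\beta_2$. *)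

theory Defs
  imports "HOL-Analysis.Analysis"
begin

(* The ambient dimension n is CARD('n), and [n] is UNIV :: 'n set. *)

definition cube :: "(real ^ 'n) set" where
  "cube = {x. \<forall>i. x $ i \<in> {0, 1}}"

definition integer_hull :: "(real ^ 'n) set \<Rightarrow> (real ^ 'n) set" where
  "integer_hull P = convex hull (P \<inter> cube)"

(* GREATEST is an attained maximum; it is unspecified when no maximum exists. *)
definition max_over :: "real ^ 'n \<Rightarrow> (real ^ 'n) set \<Rightarrow> real" where
  "max_over c P = (GREATEST m. \<exists>x\<in>P. m = c \<bullet> x)"

(* Meaningful for compact convex P inside the unit cube with nonempty integer hull. *)
definition integrality_gap :: "real ^ 'n \<Rightarrow> (real ^ 'n) set \<Rightarrow> real" where
  "integrality_gap c P = max_over c P / max_over c (integer_hull P)"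

(* The homogenising coordinate, numbered 0 on paper, is the first component of the pair. *)
definition cone_of :: "(real ^ 'n) set \<Rightarrow> (real \<times> (real ^ 'n)) set" where
  "cone_of P = {(l, l *\<^sub>R x) | l x. l \<ge> 0 \<and> x \<in> P}"

definition restr :: "'n set \<Rightarrow> real \<Rightarrow> (real ^ 'n) set" where
  "restr S t = {x \<in> cube. \<forall>i\<in>S. x $ i = t}"

definition family :: "nat \<Rightarrow> (real ^ 'n) set set" where
  "family l = {restr S 1 \<inter> restr T 0 | S T. S \<inter> T = {} \<and> card S + card T \<le> l}"

definition family_plus :: "nat \<Rightarrow> (real ^ 'n) set set" where
  "family_plus l = {restr S 1 | S. card S \<le> l}"

definition xhat :: "((real ^ 'n) set \<Rightarrow> real) \<Rightarrow> real \<times> (real ^ 'n)" where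
  "xhat y = (y cube, \<chi> i. y (restr {i} 1))"

(* A matrix is a function of a row index and a column index; only its entries at the
   index families in question are ever constrained. *)
type_synonym 'n set_matrix = "(real ^ 'n) set \<Rightarrow> (real ^ 'n) set \<Rightarrow> real"

definition column :: "'n set_matrix \<Rightarrow> (real ^ 'n) set \<Rightarrow> (real ^ 'n) set \<Rightarrow> real" where
  "column Y \<alpha> = (\<lambda>\<beta>. Y \<beta> \<alpha>)"

definition sym_psd_on :: "'i set \<Rightarrow> ('i \<Rightarrow> 'i \<Rightarrow> real) \<Rightarrow> bool" where
  "sym_psd_on I Y \<longleftrightarrow>
     (\<forall>\<alpha>\<in>I. \<forall>\<beta>\<in>I. Y \<alpha> \<beta> = Y \<beta> \<alpha>) \<and>
     (\<forall>v :: 'i \<Rightarrow> real. 0 \<le> (\<Sum>\<alpha>\<in>I. \<Sum>\<beta>\<in>I. v \<alpha> * Y \<alpha> \<beta> * v \<beta>))"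

(* Conditions shared by SA and SA_+, for rows indexed by R and columns by family k. *)
definition column_split :: "(real ^ 'n) set set \<Rightarrow> nat \<Rightarrow> 'n set_matrix \<Rightarrow> bool" where
  "column_split R k Y \<longleftrightarrow>
     (\<forall>S T j. S \<inter> T = {} \<and> card S + card T \<le> k - 1 \<and> j \<notin> S \<union> T \<longrightarrow>
        (\<forall>\<alpha>\<in>R. column Y (restr S 1 \<inter> restr T 0 \<inter> restr {j} 1) \<alpha>
             + column Y (restr S 1 \<inter> restr T 0 \<inter> restr {j} 0) \<alpha>
             = column Y (restr S 1 \<inter> restr T 0) \<alpha>))"

definition zero_if_disjoint :: "(real ^ 'n) set set \<Rightarrow> nat \<Rightarrow> 'n set_matrix \<Rightarrow> bool" where
  "zero_if_disjoint R k Y \<longleftrightarrow>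
     (\<forall>\<alpha>\<in>R. \<forall>\<beta>\<in>family k. \<alpha> \<inter> \<beta> = {} \<longrightarrow> Y \<alpha> \<beta> = 0)"

definition intersection_consistent :: "(real ^ 'n) set set \<Rightarrow> nat \<Rightarrow> 'n set_matrix \<Rightarrow> bool" where
  "intersection_consistent R k Y \<longleftrightarrow>
     (\<forall>\<alpha>1\<in>R. \<forall>\<alpha>2\<in>R. \<forall>\<beta>1\<in>family k. \<forall>\<beta>2\<in>family k.
        \<alpha>1 \<inter> \<beta>1 = \<alpha>2 \<inter> \<beta>2 \<longrightarrow> Y \<alpha>1 \<beta>1 = Y \<alpha>2 \<beta>2)"

definition SA_plus_matrices :: "nat \<Rightarrow> (real ^ 'n) set \<Rightarrow> 'n set_matrix set" where
  "SA_plus_matrices k P = {Y.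
     sym_psd_on (family k) Y \<and>
     Y cube cube = 1 \<and>
     (\<forall>\<alpha>\<in>family k. xhat (column Y \<alpha>) \<in> cone_of P \<and> (\<forall>\<beta>\<in>family k. column Y \<alpha> \<beta> \<ge> 0)) \<and>
     column_split (family k) k Y \<and>
     zero_if_disjoint (family k) k Y \<and>
     intersection_consistent (family k) k Y}"

definition SA_plus :: "nat \<Rightarrow> (real ^ 'n) set \<Rightarrow> (real ^ 'n) set" where
  "SA_plus k P = (if k = 0 then P
     else {x. \<exists>Y \<in> SA_plus_matrices k P. xhat (column Y cube) = (1, x)})"

definition LS_plus :: "nat \<Rightarrow> (real ^ 'n) set \<Rightarrow> (real ^ 'n) set" where
  "LS_plus k P = (SA_plus 1 ^^ k) P"

definition SA_matrices :: "nat \<Rightarrow> (real ^ 'n) set \<Rightarrow> 'n set_matrix set" where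
  "SA_matrices k P = {Y.
     Y cube cube = 1 \<and>
     (\<forall>\<alpha>\<in>family k. xhat (column Y \<alpha>) \<in> cone_of P) \<and>
     column_split (family_plus 1) k Y \<and>
     zero_if_disjoint (family_plus 1) k Y \<and>
     intersection_consistent (family_plus 1) k Y}"

definition SA :: "nat \<Rightarrow> (real ^ 'n) set \<Rightarrow> (real ^ 'n) set" where
  "SA k P = (if k = 0 then P
     else {x. \<exists>Y \<in> SA_matrices k P. xhat (column Y cube) = (1, x)})"

(* Only used for k up to CARD('n); beyond that the intersection is over no sets at all. *)
definition LS_tilde :: "nat \<Rightarrow> (real ^ 'n) set \<Rightarrow> (real ^ 'n) set" where
  "LS_tilde k P = (if k = 0 then P
     else (\<Inter>S \<in> {S. card S = k}. convex hull {x \<in> P. \<forall>i\<in>S. x $ i \<in> {0, 1}}))"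

definition cropped_cube :: "real \<Rightarrow> (real ^ 'n) set" where
  "cropped_cube \<rho> =
     {x. (\<forall>i. 0 \<le> x $ i \<and> x $ i \<le> 1) \<and> (\<Sum>i\<in>UNIV. x $ i) \<le> real CARD('n) - \<rho>}"

(* Makes the sum in sym_psd_on (family k) a sum over a finite set. *)
lemma finite_family: "finite (family k :: (real ^ 'n) set set)"
proof -
  have "family k \<subseteq> (\<lambda>(S, T). restr S 1 \<inter> restr T 0 :: (real ^ 'n) set) ` UNIV"
    by (auto simp: family_def)
  then show ?thesis by (rule finite_subset) simp
qed

end

theory Submission imports Defs
begin

text \<open>
  Write \<open>x = 1 - w\<close>, so that \<open>w\<close> measures the distance to the forbidden vertex \<open>1\<close>
  of the cube, and the cropped cube is \<open>0 \<le> w \<le> 1\<close>, \<open>\<Sum>w \<ge> \<rho>\<close>. The gap is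
  found by showing that all four relaxations have the same maximum of \<open>\<Sum>x\<close>, namely
  \<open>n - n\<rho>/D\<close> with \<open>D = n - k + k\<rho>\<close>; over their common integer hull it is \<open>n - 1\<close>
  (\<open>max_over_integer_hull\<close>).

  Upper bound. Being allowed to branch on a set \<open>S\<close> of \<open>k\<close> coordinates makes the inequality
  \<open>(\<Sum>i\<notin>S. w i) + \<rho> (\<Sum>i\<in>S. w i) \<ge> \<rho>\<close> valid (\<open>cut\<close>): in a branch where \<open>x j = 0\<close> for
  some \<open>j \<in> S\<close> the second sum alone reaches \<open>\<rho>\<close>, and in the branch where \<open>x = 1\<close> on
  \<open>S\<close> the inequality is the one that defines the cropped cube. This is immediate for
  \<open>LS_tilde\<close> (\<open>LS_tilde_cut\<close>). For Sherali--Adams the columns of the certificate play the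
  role of the branches (\<open>SA_cut\<close>). This covers the tighter \<open>SA_plus\<close> too and, one
  coordinate at a time, \<open>LS_plus\<close> (\<open>LS_plus_cut\<close>). Using the cut for the \<open>k\<close>
  coordinates with the largest \<open>w i\<close> bounds \<open>\<Sum>w\<close> from below (\<open>sum_le_of_cuts\<close>).

  Lower bound. The constant point with \<open>w i = q = \<rho>/D\<close> is the mean of an actual probability
  distribution on cube vertices: mass \<open>q\<close> on each vertex with exactly one zero and the remaining
  mass on the vertex \<open>1\<close>. The matrix of probabilities of intersections is then positive
  semidefinite, and it satisfies all the linear conditions on a certificate for free, except that
  conditional means must lie in the relaxed set (\<open>SA_plus_of_distribution\<close>). Conditioning on
  a zero gives a single vertex of the cropped cube; conditioning on \<open>x = 1\<close> on a set of
  \<open>s \<le> k\<close> coordinates leaves a mean in the cropped cube as long as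
  \<open>(n - s) q \<ge> \<rho> (1 - s q)\<close>. At \<open>s = k\<close> this is an equality, which is where \<open>q\<close> comes from.
  For \<open>LS_plus\<close> the same construction is repeated, since conditioning preserves the shape of
  the distribution and uses up only as many levels as coordinates (\<open>robust_condition_on\<close>).
\<close>

section \<open>Cuts valid for the relaxations\<close>

text \<open>
  In terms of \<open>w = 1 - x\<close> the inequality is
  \<open>(\<Sum>i\<notin>S. w i) + \<rho> (\<Sum>i\<in>S. w i) \<ge> \<rho>\<close>, and \<open>S\<close> is the set of coordinates that may be
  branched on.
\<close>
definition cut :: "real \<Rightarrow> 'n set \<Rightarrow> (real ^ 'n) set" where
  "cut \<rho> S = {x. \<rho> \<le> (\<Sum>i\<in>UNIV. (if i \<in> S then \<rho> else 1) * (1 - x $ i))}"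

lemma restr_empty [simp]: "restr {} t = cube"
  by (simp add: restr_def)

lemma restr_Int_cube [simp]: "restr S t \<inter> cube = restr S t" "cube \<inter> restr S t = restr S t"
  by (auto simp: restr_def)

lemma restr_Un: "restr S t \<inter> restr T t = restr (S \<union> T) t"
  by (auto simp: restr_def)

lemma restr_clash: "i \<in> S \<Longrightarrow> i \<in> T \<Longrightarrow> restr S 1 \<inter> restr T 0 = {}"
  by (auto simp: restr_def)

lemma restr_in_family: "S \<inter> T = {} \<Longrightarrow> card S + card T \<le> k \<Longrightarrow> restr S 1 \<inter> restr T 0 \<in> family k"
  by (auto simp: family_def)

lemma cube_in_family: "cube \<in> family k"
  using restr_in_family[of "{}" "{}" k] by simp

lemma restr_one_in_family: "card S \<le> k \<Longrightarrow> restr S 1 \<in> family k"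
  using restr_in_family[of S "{}" k] by simp

lemma cube_in_family_plus: "cube \<in> family_plus k"
  unfolding family_plus_def by (rule CollectI, rule exI[of _ "{}"]) simp

lemma restr_single_in_family_plus: "restr {i} 1 \<in> family_plus 1"
  unfolding family_plus_def by (rule CollectI, rule exI[of _ "{i}"]) simp

lemma family_plus_subset_family: "1 \<le> k \<Longrightarrow> family_plus 1 \<subseteq> family k"
  by (auto simp: family_plus_def intro!: restr_one_in_family)

lemma cone_of_one_iff: "(1, x) \<in> cone_of Q \<longleftrightarrow> x \<in> Q"
  by (auto simp: cone_of_def)

lemma SA_subset: "SA k Q \<subseteq> Q"
proof (cases "k = 0")
  case False
  show ?thesis
  proof
    fix x assume "x \<in> SA k Q"
    then obtain Y where "Y \<in> SA_matrices k Q" "xhat (column Y cube) = (1, x)"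
      using False by (auto simp: SA_def)
    then have "(1, x) \<in> cone_of Q"
      using cube_in_family[of k] by (force simp: SA_matrices_def)
    then show "x \<in> Q" by (simp add: cone_of_one_iff)
  qed
qed (simp add: SA_def)

lemma SA_plus_subset_SA: "SA_plus k Q \<subseteq> SA k Q"
proof (cases "k = 0")
  case False
  then have sub: "family_plus 1 \<subseteq> (family k :: (real ^ 'a) set set)"
    by (intro family_plus_subset_family) simp
  have "SA_plus_matrices k Q \<subseteq> SA_matrices k Q"
  proof
    fix Y assume Y: "Y \<in> SA_plus_matrices k Q"
    have "column_split (family_plus 1) k Y"
      using Y sub unfolding SA_plus_matrices_def column_split_def by blast
    moreover have "zero_if_disjoint (family_plus 1) k Y"
      using Y sub unfolding SA_plus_matrices_def zero_if_disjoint_def by blast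
    moreover have "intersection_consistent (family_plus 1) k Y"
      unfolding intersection_consistent_def
    proof (intro ballI impI)
      fix \<alpha>1 \<alpha>2 \<beta>1 \<beta>2 :: "(real ^ 'a) set"
      assume "\<alpha>1 \<in> family_plus 1" "\<alpha>2 \<in> family_plus 1" "\<beta>1 \<in> family k" "\<beta>2 \<in> family k"
        "\<alpha>1 \<inter> \<beta>1 = \<alpha>2 \<inter> \<beta>2"
      moreover have "intersection_consistent (family k) k Y"
        using Y by (simp add: SA_plus_matrices_def)
      ultimately show "Y \<alpha>1 \<beta>1 = Y \<alpha>2 \<beta>2"
        using sub unfolding intersection_consistent_def by (meson subsetD)
    qed
    ultimately show "Y \<in> SA_matrices k Q"
      using Y by (simp add: SA_plus_matrices_def SA_matrices_def)
  qed
  then show ?thesis using False by (auto simp: SA_plus_def SA_def)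
qed (simp add: SA_plus_def SA_def)

text \<open>
  Branching on the coordinates of \<open>S\<close> one after the other, the column identity splits the column
  of \<open>cube\<close> into the columns of sets on which \<open>x j = 0\<close> for some \<open>j \<in> S\<close> and the column
  of the set on which \<open>x = 1\<close> throughout \<open>S\<close>. The homogenised cut holds on
  each of them. Starting from a set \<open>Q\<close> that already satisfies the cut for \<open>S'\<close> makes
  the statement usable both in one shot (\<open>S' = {}\<close>) and one coordinate at a time, as for the
  iterated operator.
\<close>
lemma SA_cut:
  fixes Q :: "(real ^ 'n) set"
  assumes \<rho>: "0 \<le> \<rho>"
    and box: "\<And>x i. x \<in> Q \<Longrightarrow> x $ i \<le> 1"
    and Q: "Q \<subseteq> cut \<rho> S'" and disj: "S \<inter> S' = {}" and card: "card S \<le> k" and k: "1 \<le> k"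
  shows "SA k Q \<subseteq> cut \<rho> (S \<union> S')"
proof
  fix x assume "x \<in> SA k Q"
  then obtain Y where Y: "Y \<in> SA_matrices k Q" and x: "xhat (column Y cube) = (1, x)"
    using k by (auto simp: SA_def)
  \<comment> \<open>Slack of the cut for \<open>R\<close>, homogenised so that it is linear in the column \<open>y\<close>.\<close>
  define L where "L R (y :: (real ^ 'n) set \<Rightarrow> real) =
    (\<Sum>i\<in>UNIV. (if i \<in> R then \<rho> else 1) * (y cube - y (restr {i} 1))) - \<rho> * y cube"
    for R y
  have col: "\<exists>l z. l \<ge> 0 \<and> z \<in> Q \<and> column Y \<alpha> cube = l \<and>
      (\<forall>i. column Y \<alpha> (restr {i} 1) = l * z $ i)" if "\<alpha> \<in> family k" for \<alpha>
  proof -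
    have "xhat (column Y \<alpha>) \<in> cone_of Q" using Y that by (auto simp: SA_matrices_def)
    then show ?thesis by (auto simp: cone_of_def xhat_def vec_eq_iff)
  qed
  have base: "0 \<le> L (S \<union> S') (column Y (restr S 1))"
  proof -
    have fam: "restr S 1 \<in> family k" using card by (rule restr_one_in_family)
    obtain l z where lz: "l \<ge> 0" "z \<in> Q" and cu: "column Y (restr S 1) cube = l"
      and ro: "\<And>i. column Y (restr S 1) (restr {i} 1) = l * z $ i"
      using col[OF fam] by blast
    \<comment> \<open>Rows \<open>i|1\<close> and \<open>cube\<close> meet the column set \<open>S|1\<close> in the same set.\<close>
    have one: "l * z $ i = l" if "i \<in> S" for i
    proof -
      have "restr {i} 1 \<inter> restr S 1 = cube \<inter> restr S (1::real)"
        using that by (auto simp: restr_Un insert_absorb)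
      then have "Y (restr {i} 1) (restr S 1) = Y cube (restr S 1)"
        using Y fam cube_in_family_plus[of 1] restr_single_in_family_plus[of i]
        unfolding SA_matrices_def intersection_consistent_def by blast
      then show ?thesis using cu ro by (simp add: column_def)
    qed
    have "L (S \<union> S') (column Y (restr S 1))
        = (\<Sum>i\<in>UNIV. (if i \<in> S \<union> S' then \<rho> else 1) * (l - l * z $ i)) - \<rho> * l"
      by (simp add: L_def cu ro)
    also have "\<dots> = (\<Sum>i\<in>UNIV. l * ((if i \<in> S' then \<rho> else 1) * (1 - z $ i))) - \<rho> * l"
    proof (intro arg_cong2[of _ _ _ _ "(-)"] sum.cong refl)
      fix i
      show "(if i \<in> S \<union> S' then \<rho> else 1) * (l - l * z $ i)
          = l * ((if i \<in> S' then \<rho> else 1) * (1 - z $ i))"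
      proof (cases "i \<in> S")
        case True
        then show ?thesis using one[of i] disj by (auto simp: algebra_simps)
      qed (simp add: algebra_simps)
    qed
    also have "\<dots> = l * ((\<Sum>i\<in>UNIV. (if i \<in> S' then \<rho> else 1) * (1 - z $ i)) - \<rho>)"
      by (simp add: sum_distrib_left algebra_simps)
    also have "\<dots> \<ge> 0" using lz Q by (auto simp: cut_def)
    finally show ?thesis .
  qed
  \<comment> \<open>The coordinates in \<open>V\<close> are the ones on which the condition \<open>x = 1\<close> has been dropped.\<close>
  have "0 \<le> L (S \<union> S') (column Y (restr (S - V) 1))" if "V \<subseteq> S" for V
    using finite_subset[OF that finite] that
  proof (induction V rule: finite_induct)
    case empty
    then show ?case using base by simp
  next
    case (insert j V)
    define U where "U = S - insert j V"
    have jS: "j \<in> S" and jU: "j \<notin> U" using insert by (auto simp: U_def)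
    have SV: "S - V = insert j U" using insert by (auto simp: U_def)
    have "card (insert j U) \<le> card S" using SV by (intro card_mono) auto
    then have cU: "Suc (card U) \<le> k" using card jU by simp
    have split: "column Y (restr (insert j U) 1) \<alpha> + column Y (restr U 1 \<inter> restr {j} 0) \<alpha>
        = column Y (restr U 1) \<alpha>" if "\<alpha> \<in> family_plus 1" for \<alpha>
    proof -
      have "column_split (family_plus 1) k Y" using Y by (simp add: SA_matrices_def)
      then have "column Y (restr U 1 \<inter> restr {} 0 \<inter> restr {j} 1) \<alpha>
         + column Y (restr U 1 \<inter> restr {} 0 \<inter> restr {j} 0) \<alpha>
             = column Y (restr U 1 \<inter> restr {} 0) \<alpha>"
        unfolding column_split_def using cU jU that
        by (elim allE[of _ U] allE[of _ "{}"] allE[of _ j]) auto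
      then show ?thesis by (simp add: restr_Un)
    qed
    have fam: "restr U 1 \<inter> restr {j} 0 \<in> family k"
      using cU jU by (intro restr_in_family) auto
    obtain l z where lz: "l \<ge> 0" "z \<in> Q" and cu: "column Y (restr U 1 \<inter> restr {j} 0) cube = l"
      and ro: "\<And>i. column Y (restr U 1 \<inter> restr {j} 0) (restr {i} 1) = l * z $ i"
      using col[OF fam] by blast
    have "restr {j} 1 \<inter> (restr U 1 \<inter> restr {j} 0) = {}"
      using restr_clash[of j "{j}" "{j}"] by auto
    then have zero: "l * z $ j = 0"
      using Y fam restr_single_in_family_plus[of j] ro[of j]
      unfolding SA_matrices_def zero_if_disjoint_def column_def by auto
    \<comment> \<open>Where \<open>x j = 0\<close>, the term of \<open>j\<close> alone pays for the right-hand side.\<close>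
    have "\<rho> * l = (if j \<in> S \<union> S' then \<rho> else 1) * (l - l * z $ j)"
      using jS zero by simp
    also have "\<dots> \<le> (\<Sum>i\<in>UNIV. (if i \<in> S \<union> S' then \<rho> else 1) * (l - l * z $ i))"
      using \<rho> lz box[OF lz(2)] by (intro member_le_sum) (auto simp: mult_left_le)
    finally have nonneg: "0 \<le> L (S \<union> S') (column Y (restr U 1 \<inter> restr {j} 0))"
      by (simp add: L_def cu ro)
    have "L (S \<union> S') (column Y (restr U 1)) = L (S \<union> S') (column Y (restr (insert j U) 1))
        + L (S \<union> S') (column Y (restr U 1 \<inter> restr {j} 0))"
      unfolding L_def split[OF cube_in_family_plus, symmetric]
        split[OF restr_single_in_family_plus, symmetric]
      by (simp add: algebra_simps sum.distrib sum_subtractf)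
    moreover have "0 \<le> L (S \<union> S') (column Y (restr (insert j U) 1))"
      using insert SV by simp
    ultimately show ?case using nonneg by (simp add: U_def)
  qed
  from this[of S] have "0 \<le> L (S \<union> S') (column Y cube)" by simp
  moreover have "column Y cube cube = 1" "\<And>i. column Y cube (restr {i} 1) = x $ i"
    using x by (auto simp: xhat_def)
  ultimately show "x \<in> cut \<rho> (S \<union> S')" by (simp add: L_def cut_def)
qed

lemma cropped_cube_subset_cut: "cropped_cube \<rho> \<subseteq> cut \<rho> {}"
  by (auto simp: cropped_cube_def cut_def sum_subtractf)

lemma LS_plus_subset: "LS_plus k Q \<subseteq> Q"
proof (induction k)
  case (Suc k)
  then show ?case
    using SA_plus_subset_SA[of 1 "LS_plus k Q"] SA_subset[of 1 "LS_plus k Q"]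
    by (simp add: LS_plus_def)
qed (simp add: LS_plus_def)

text \<open>
  Each application of the operator adds one coordinate to the branching set of a cut that is
  already valid for the set it is applied to.
\<close>
lemma LS_plus_cut:
  assumes \<rho>: "0 \<le> \<rho>"
  shows "LS_plus (card S) (cropped_cube \<rho>) \<subseteq> cut \<rho> S"
  using finite[of S]
proof (induction S rule: finite_induct)
  case empty
  then show ?case using cropped_cube_subset_cut by (simp add: LS_plus_def)
next
  case (insert j S)
  let ?Q = "LS_plus (card S) (cropped_cube \<rho>)"
  have "LS_plus (card (insert j S)) (cropped_cube \<rho>) \<subseteq> SA 1 ?Q"
    using insert SA_plus_subset_SA[of 1 ?Q] by (simp add: LS_plus_def)
  also have "\<dots> \<subseteq> cut \<rho> ({j} \<union> S)"
    using insert \<rho> LS_plus_subset[of "card S" "cropped_cube \<rho>"]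
    by (intro SA_cut) (auto simp: cropped_cube_def)
  finally show ?case by simp
qed

lemma convex_cut: "convex (cut \<rho> S)"
proof -
  let ?c = "\<chi> i. if i \<in> S then \<rho> else 1"
  have "cut \<rho> S = {x. ?c \<bullet> x \<le> ?c \<bullet> 1 - \<rho>}"
    by (auto simp: cut_def inner_vec_def sum_subtractf right_diff_distrib)
  then show ?thesis by (simp add: convex_halfspace_le)
qed

lemma LS_tilde_cut:
  fixes S :: "'n::finite set"
  assumes \<rho>: "0 \<le> \<rho>"
  shows "LS_tilde (card S) (cropped_cube \<rho>) \<subseteq> cut \<rho> S"
proof (cases "S = {}")
  case True
  then show ?thesis using cropped_cube_subset_cut by (simp add: LS_tilde_def)
next
  case False
  let ?P = "{x \<in> cropped_cube \<rho>. \<forall>i\<in>S. x $ i \<in> {0, 1}}"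
  have "?P \<subseteq> cut \<rho> S"
  proof
    fix x assume x: "x \<in> ?P"
    then have le: "x $ i \<le> 1" for i by (auto simp: cropped_cube_def)
    show "x \<in> cut \<rho> S"
    proof (cases "\<exists>j\<in>S. x $ j = 0")
      case True
      then obtain j where j: "j \<in> S" "x $ j = 0" by blast
      then have "\<rho> = (if j \<in> S then \<rho> else 1) * (1 - x $ j)" by simp
      also have "\<dots> \<le> (\<Sum>i\<in>UNIV. (if i \<in> S then \<rho> else 1) * (1 - x $ i))"
        using \<rho> le by (intro member_le_sum) auto
      finally show ?thesis by (simp add: cut_def)
    next
      case False
      then have "(\<Sum>i\<in>UNIV. (if i \<in> S then \<rho> else 1) * (1 - x $ i))
          = (\<Sum>i\<in>UNIV. (if i \<in> {} then \<rho> else 1) * (1 - x $ i))"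
        using x by (intro sum.cong) auto
      moreover have "x \<in> cut \<rho> {}" using x cropped_cube_subset_cut by blast
      ultimately show ?thesis by (simp only: cut_def mem_Collect_eq)
    qed
  qed
  then have "convex hull ?P \<subseteq> cut \<rho> S" by (intro hull_minimal convex_cut)
  moreover have "LS_tilde (card S) (cropped_cube \<rho>) \<subseteq> convex hull ?P"
    using False by (auto simp: LS_tilde_def)
  ultimately show ?thesis by blast
qed

text \<open>
  Discarding an element of least weight does not decrease the average, so discarding one element
  at a time leaves a set of \<open>k\<close> elements whose average is at least that of \<open>A\<close>. The inequality
  is multiplied out to admit \<open>k = 0\<close>.
\<close>
lemma heavy_subset:
  fixes w :: "'a \<Rightarrow> real"
  assumes "finite A" and "k \<le> card A"
  shows "\<exists>S\<subseteq>A. card S = k \<and> real k * sum w A \<le> real (card A) * sum w S"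
  using assms
proof (induction "card A" arbitrary: A)
  case 0
  then show ?case by auto
next
  case (Suc m)
  show ?case
  proof (cases "k = card A")
    case False
    have "A \<noteq> {}" using Suc by auto
    then obtain j where j: "j \<in> A" and min: "\<And>i. i \<in> A \<Longrightarrow> w j \<le> w i"
      using ex_min_if_finite[of "w ` A"] Suc.prems(1)
      by (metis arg_min_if_finite(1,2) linorder_not_le)
    have cA: "card (A - {j}) = m" using j Suc by simp
    with Suc obtain S where S: "S \<subseteq> A - {j}" "card S = k"
      and le: "real k * sum w (A - {j}) \<le> real m * sum w S"
      using False by (metis finite_Diff le_neq_implies_less less_Suc_eq_le)
    have "m * w j \<le> sum w (A - {j})"
      using sum_bounded_below[of "A - {j}" "w j" w] min cA by simp
    then have k: "real k * (m * w j) \<le> real k * sum w (A - {j})"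
      by (intro mult_left_mono) auto
    have sA: "sum w A = w j + sum w (A - {j})"
      using j Suc.prems(1) by (simp add: sum.remove)
    have ge: "real k * sum w A \<le> real (Suc m) * sum w S"
    proof (cases "m = 0")
      case True
      then have "k = 0" using False Suc by linarith
      moreover have "S = {}"
        using S \<open>k = 0\<close> finite_subset[OF S(1)] Suc.prems(1) by simp
      ultimately show ?thesis by simp
    next
      case m: False
      have "m * (real k * sum w A) = real k * (m * w j) + m * (real k * sum w (A - {j}))"
        by (simp add: sA algebra_simps)
      also have "\<dots> \<le> Suc m * (real k * sum w (A - {j}))"
        using k by (simp add: algebra_simps)
      also have "\<dots> \<le> Suc m * (real m * sum w S)"
        using le by (intro mult_left_mono) auto
      finally have "m * (real k * sum w A) \<le> m * (Suc m * sum w S)"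
        by (simp add: algebra_simps)
      then show ?thesis using m by simp
    qed
    then show ?thesis using S Suc by auto
  qed auto
qed

text \<open>
  The cut reads \<open>\<Sum>w - (1 - \<rho>) (\<Sum>i\<in>S. w i) \<ge> \<rho>\<close>, so it is strongest for a heavy \<open>S\<close>, where
  \<open>(\<Sum>i\<in>S. w i) \<ge> (k/n) \<Sum>w\<close>. What remains is \<open>\<Sum>w \<cdot> D/n \<ge> \<rho>\<close>.
\<close>
lemma sum_le_of_cuts:
  fixes x :: "real ^ 'n"
  assumes "\<rho> < 1" and D: "0 < real CARD('n) - real k + real k * \<rho>" and k: "k \<le> CARD('n)"
    and cuts: "\<And>S. card S = k \<Longrightarrow> x \<in> cut \<rho> S"
  shows "(\<Sum>i\<in>UNIV. x $ i)
    \<le> real CARD('n) - real CARD('n) * \<rho> / (real CARD('n) - real k + real k * \<rho>)"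
proof -
  define w where "w i = 1 - x $ i" for i
  obtain S where S: "card S = k" and heavy: "real k * sum w UNIV \<le> CARD('n) * sum w S"
    using heavy_subset[of UNIV k w] k by auto
  have "\<rho> \<le> (\<Sum>i\<in>UNIV. (if i \<in> S then \<rho> else 1) * w i)"
    using cuts[OF S] by (simp add: cut_def w_def)
  also have "\<dots> = (\<Sum>i\<in>UNIV. w i - (if i \<in> S then (1 - \<rho>) * w i else 0))"
    by (intro sum.cong) (auto simp: algebra_simps)
  also have "\<dots> = sum w UNIV - (1 - \<rho>) * sum w S"
    by (simp add: sum_subtractf sum.If_cases sum_distrib_left)
  finally have "CARD('n) * \<rho> \<le> CARD('n) * (sum w UNIV - (1 - \<rho>) * sum w S)"
    by (intro mult_left_mono) auto
  also have "\<dots> = CARD('n) * sum w UNIV - (1 - \<rho>) * (CARD('n) * sum w S)"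
    by (simp add: algebra_simps)
  also have "\<dots> \<le> CARD('n) * sum w UNIV - (1 - \<rho>) * (k * sum w UNIV)"
    using heavy \<open>\<rho> < 1\<close> by (intro diff_left_mono mult_left_mono) auto
  also have "\<dots> = sum w UNIV * (real CARD('n) - real k + real k * \<rho>)"
    by (simp add: algebra_simps)
  finally have "CARD('n) * \<rho> / (real CARD('n) - real k + real k * \<rho>) \<le> sum w UNIV"
    using D by (simp add: pos_divide_le_eq)
  moreover have "sum w UNIV = CARD('n) - (\<Sum>i\<in>UNIV. x $ i)"
    by (simp add: w_def sum_subtractf)
  ultimately show ?thesis by linarith
qed

section \<open>Certificates from distributions on vertices\<close>

text \<open>
  The entry for \<open>\<alpha>\<close> and \<open>\<beta>\<close> is the probability of \<open>\<alpha> \<inter> \<beta>\<close>. Such a matrix is the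
  mixture of the rank-one matrices of the vertices in the support, hence positive semidefinite;
  additivity of probability gives the column identity, and a column is a conditional mean scaled
  by the probability of the condition.
\<close>
lemma SA_plus_of_distribution:
  fixes pt :: "'i::finite \<Rightarrow> real ^ 'n"
  assumes m: "\<And>a. 0 \<le> m a" "sum m UNIV = 1"
    and pt: "\<And>a. pt a \<in> cube"
    and cone: "\<And>\<alpha>. \<alpha> \<in> family k \<Longrightarrow>
      (sum m {a. pt a \<in> \<alpha>}, \<Sum>a | pt a \<in> \<alpha>. m a *\<^sub>R pt a) \<in> cone_of Q"
  shows "(\<Sum>a\<in>UNIV. m a *\<^sub>R pt a) \<in> SA_plus k Q"
proof -
  define Y where "Y \<alpha> \<beta> = sum m {a. pt a \<in> \<alpha> \<inter> \<beta>}" for \<alpha> \<beta>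
  have xhat: "xhat (column Y \<alpha>) = (sum m {a. pt a \<in> \<alpha>}, \<Sum>a | pt a \<in> \<alpha>. m a *\<^sub>R pt a)" for \<alpha>
  proof -
    have "sum m {a. pt a \<in> restr {i} 1 \<inter> \<alpha>} = (\<Sum>a | pt a \<in> \<alpha>. m a * pt a $ i)" for i
    proof -
      have "(\<Sum>a | pt a \<in> \<alpha>. m a * pt a $ i) = (\<Sum>a | pt a \<in> \<alpha>. if pt a $ i = 1 then m a else 0)"
        using pt by (intro sum.cong) (auto simp: cube_def)
      also have "\<dots> = sum m ({a. pt a \<in> \<alpha>} \<inter> {a. pt a $ i = 1})"
        by (simp add: sum.If_cases)
      also have "{a. pt a \<in> \<alpha>} \<inter> {a. pt a $ i = 1} = {a. pt a \<in> restr {i} 1 \<inter> \<alpha>}"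
        using pt by (auto simp: restr_def)
      finally show ?thesis by simp
    qed
    moreover have "{a. pt a \<in> cube \<inter> \<alpha>} = {a. pt a \<in> \<alpha>}" using pt by auto
    ultimately show ?thesis by (simp add: xhat_def column_def Y_def vec_eq_iff)
  qed
  have all: "{a. pt a \<in> cube} = UNIV" using pt by auto
  show ?thesis
  proof (cases "k = 0")
    case True
    have "(sum m UNIV, \<Sum>a\<in>UNIV. m a *\<^sub>R pt a) \<in> cone_of Q"
      using cone[OF cube_in_family[of k]] by (simp add: all)
    then show ?thesis using True m by (simp add: SA_plus_def cone_of_one_iff)
  next
    case False
    have psd: "sym_psd_on (family k) Y"
      unfolding sym_psd_on_def
    proof (intro conjI ballI allI)
      show "Y \<alpha> \<beta> = Y \<beta> \<alpha>" for \<alpha> \<beta> by (simp add: Y_def Int_commute)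
      fix v :: "(real ^ 'n) set \<Rightarrow> real"
      have Y: "Y \<alpha> \<beta> = (\<Sum>a\<in>UNIV. m a * (indicator \<alpha> (pt a) * indicator \<beta> (pt a)))" for \<alpha> \<beta>
        unfolding Y_def
        by (rule sum.mono_neutral_cong_left) (auto simp: indicator_def)
      have "(\<Sum>\<alpha>\<in>family k. \<Sum>\<beta>\<in>family k. v \<alpha> * Y \<alpha> \<beta> * v \<beta>)
        = (\<Sum>\<alpha>\<in>family k. \<Sum>\<beta>\<in>family k. \<Sum>a\<in>UNIV.
             m a * (v \<alpha> * indicator \<alpha> (pt a)) * (v \<beta> * indicator \<beta> (pt a)))"
        by (simp add: Y sum_distrib_left sum_distrib_right mult_ac)
      also have "\<dots> = (\<Sum>\<alpha>\<in>family k. \<Sum>a\<in>UNIV. \<Sum>\<beta>\<in>family k.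
             m a * (v \<alpha> * indicator \<alpha> (pt a)) * (v \<beta> * indicator \<beta> (pt a)))"
        by (intro sum.cong refl sum.swap)
      also have "\<dots> = (\<Sum>a\<in>UNIV. \<Sum>\<alpha>\<in>family k. \<Sum>\<beta>\<in>family k.
             m a * (v \<alpha> * indicator \<alpha> (pt a)) * (v \<beta> * indicator \<beta> (pt a)))"
        by (rule sum.swap)
      also have "\<dots> = (\<Sum>a\<in>UNIV. m a * (\<Sum>\<alpha>\<in>family k. v \<alpha> * indicator \<alpha> (pt a))\<^sup>2)"
        unfolding power2_eq_square sum_product by (simp add: sum_distrib_left mult.assoc)
      also have "\<dots> \<ge> 0" using m by (intro sum_nonneg) auto
      finally show "0 \<le> (\<Sum>\<alpha>\<in>family k. \<Sum>\<beta>\<in>family k. v \<alpha> * Y \<alpha> \<beta> * v \<beta>)" .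
    qed
    have split: "column_split (family k) k Y"
      unfolding column_split_def
    proof (intro allI impI ballI)
      fix S T :: "'n set" and j \<alpha>
      let ?A = "restr S 1 \<inter> restr T 0 :: (real ^ 'n) set"
      have "{a. pt a \<in> \<alpha> \<inter> ?A}
        = {a. pt a \<in> \<alpha> \<inter> (?A \<inter> restr {j} 1)} \<union> {a. pt a \<in> \<alpha> \<inter> (?A \<inter> restr {j} 0)}"
        by (auto simp: restr_def cube_def)
      moreover have "{a. pt a \<in> \<alpha> \<inter> (?A \<inter> restr {j} 1)} \<inter> {a. pt a \<in> \<alpha> \<inter> (?A \<inter> restr {j} 0)} = {}"
        by (auto simp: restr_def)
      ultimately show "column Y (?A \<inter> restr {j} 1) \<alpha> + column Y (?A \<inter> restr {j} 0) \<alpha> = column Y ?A \<alpha>"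
        unfolding column_def Y_def by (simp add: sum.union_disjoint)
    qed
    have zero: "zero_if_disjoint (family k) k Y"
      unfolding zero_if_disjoint_def Y_def by simp
    have consistent: "intersection_consistent (family k) k Y"
      unfolding intersection_consistent_def Y_def by simp
    have "Y \<in> SA_plus_matrices k Q"
    proof -
      have "Y cube cube = 1" using m pt by (simp add: Y_def)
      moreover have "0 \<le> column Y \<alpha> \<beta>" for \<alpha> \<beta>
        using m by (simp add: column_def Y_def sum_nonneg)
      ultimately show ?thesis
        using psd split zero consistent cone by (simp add: SA_plus_matrices_def xhat)
    qed
    moreover have "xhat (column Y cube) = (1, \<Sum>a\<in>UNIV. m a *\<^sub>R pt a)"
      by (simp add: xhat all m)
    ultimately show ?thesis using False by (auto simp: SA_plus_def)
  qed
qed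

text \<open>
  Let \<open>1 - w\<close> be the mean of the distribution with mass \<open>w $ i\<close> on the vertex whose only
  zero is at \<open>i\<close>, and the remaining mass on \<open>1\<close>. Conditioning it on the coordinates in
  \<open>S\<close> being one gives a distribution of the same kind, with mean \<open>1 - condition_on S w\<close>,
  provided that the condition has positive probability.
\<close>
definition condition_on :: "'n set \<Rightarrow> real ^ 'n \<Rightarrow> real ^ 'n" where
  "condition_on S w = (\<chi> i. if i \<in> S then 0 else w $ i / (1 - (\<Sum>j\<in>S. w $ j)))"

text \<open>
  A set in the family fixes some coordinates \<open>S\<close> to one and some \<open>T\<close> to zero. Since no vertex
  in the support has two zeros, \<open>T \<noteq> {}\<close> leaves at most a single vertex, and only \<open>T = {}\<close>
  asks for a genuine conditional mean.
\<close>
lemma SA_plus_near_one: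
  fixes w :: "real ^ 'n"
  assumes w: "\<And>i. 0 \<le> w $ i" "(\<Sum>i\<in>UNIV. w $ i) \<le> 1"
    and vert: "\<And>i. 1 - axis i 1 \<in> Q"
    and cond: "\<And>S. card S \<le> k \<Longrightarrow> (\<Sum>i\<in>S. w $ i) < 1 \<Longrightarrow> 1 - condition_on S w \<in> Q"
  shows "1 - w \<in> SA_plus k Q"
proof -
  \<comment> \<open>\<open>None\<close> stands for the vertex \<open>1\<close>, \<open>Some i\<close> for the vertex whose only zero is at \<open>i\<close>.\<close>
  define pt :: "'n option \<Rightarrow> real ^ 'n" where
    "pt = (\<lambda>a. case a of None \<Rightarrow> 1 | Some i \<Rightarrow> 1 - axis i 1)"
  define m :: "'n option \<Rightarrow> real" where
    "m = (\<lambda>a. case a of None \<Rightarrow> 1 - (\<Sum>i\<in>UNIV. w $ i) | Some i \<Rightarrow> w $ i)"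
  have pt_nth: "pt a $ j = (if a = Some j then 0 else 1)" for a j
    by (auto simp: pt_def axis_def split: option.splits)
  have m_nonneg: "0 \<le> m a" for a using w by (auto simp: m_def split: option.splits)
  have sum_option: "sum f (insert None (Some ` A)) = f None + (\<Sum>i\<in>A. f (Some i))"
    for f :: "'n option \<Rightarrow> real" and A
    by (simp add: sum.reindex)
  have mean: "(\<Sum>a\<in>insert None (Some ` (- S)). m a *\<^sub>R pt a)
      = (1 - (\<Sum>i\<in>S. w $ i)) *\<^sub>R 1 - (\<chi> i. if i \<in> S then 0 else w $ i)" (is "?l = ?r")
    and mass: "sum m (insert None (Some ` (- S))) = 1 - (\<Sum>i\<in>S. w $ i)" for S
  proof -
    have tot: "(\<Sum>i\<in>UNIV. w $ i) = (\<Sum>i\<in>S. w $ i) + (\<Sum>i\<in>-S. w $ i)"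
      by (metis Compl_eq_Diff_UNIV finite sum.subset_diff subset_UNIV add.commute)
    show mass: "sum m (insert None (Some ` (- S))) = 1 - (\<Sum>i\<in>S. w $ i)"
      unfolding sum_option by (simp add: m_def tot)
    show "?l = ?r"
    proof (rule vec_eq_iff[THEN iffD2], rule allI)
      fix j
      have "?l $ j = (\<Sum>a\<in>insert None (Some ` (- S)). m a - (if a = Some j then m a else 0))"
        by (auto simp: pt_nth intro!: sum.cong)
      also have "\<dots> = 1 - (\<Sum>i\<in>S. w $ i) - (if j \<in> S then 0 else w $ j)"
        unfolding sum_subtractf mass by (auto simp: m_def)
      finally show "?l $ j = ?r $ j" by simp
    qed
  qed
  have U: "insert None (Some ` (- {})) = (UNIV :: 'n option set)"
    by (auto simp: UNIV_option_conv)
  have "(\<Sum>a\<in>UNIV. m a *\<^sub>R pt a) \<in> SA_plus k Q"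
  proof (rule SA_plus_of_distribution)
    show "0 \<le> m a" for a by (rule m_nonneg)
    show "sum m UNIV = 1" using mass[of "{}", unfolded U] by simp
    show "pt a \<in> cube" for a by (simp add: cube_def pt_nth)
    fix \<alpha> :: "(real ^ 'n) set" assume "\<alpha> \<in> family k"
    then obtain S T where \<alpha>: "\<alpha> = restr S 1 \<inter> restr T 0" and c: "card S + card T \<le> k"
      by (auto simp: family_def)
    have mem: "pt a \<in> \<alpha> \<longleftrightarrow> (\<forall>i\<in>S. a \<noteq> Some i) \<and> (\<forall>i\<in>T. a = Some i)" for a
      by (auto simp: \<alpha> restr_def cube_def pt_nth)
    have zero: "(0, 0) \<in> cone_of Q" using vert by (force simp: cone_of_def)
    show "(sum m {a. pt a \<in> \<alpha>}, \<Sum>a | pt a \<in> \<alpha>. m a *\<^sub>R pt a) \<in> cone_of Q"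
    proof (cases "T = {}")
      case True
      have J: "{a. pt a \<in> \<alpha>} = insert None (Some ` (- S))"
        using True by (auto simp: mem image_iff) (metis ComplI not_None_eq)
      let ?l = "1 - (\<Sum>i\<in>S. w $ i)"
      have l: "0 \<le> ?l" using mass[of S] m_nonneg by (metis sum_nonneg)
      show ?thesis
      proof (cases "?l = 0")
        case l0: True
        then have "m a = 0" if "a \<in> {a. pt a \<in> \<alpha>}" for a
          using mass[of S] J m_nonneg that sum_nonneg_eq_0_iff[of "{a. pt a \<in> \<alpha>}" m] by auto
        then show ?thesis using zero by simp
      next
        case False
        then have "1 - condition_on S w \<in> Q" using l c by (intro cond) auto
        moreover have "(\<Sum>a | pt a \<in> \<alpha>. m a *\<^sub>R pt a) = ?l *\<^sub>R (1 - condition_on S w)"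
          unfolding J mean using False by (auto simp: vec_eq_iff condition_on_def field_simps)
        moreover have "sum m {a. pt a \<in> \<alpha>} = ?l" using J mass by simp
        ultimately show ?thesis using l by (auto simp: cone_of_def)
      qed
    next
      case False
      then obtain i where i: "i \<in> T" by blast
      then have "{a. pt a \<in> \<alpha>} \<subseteq> {Some i}" by (auto simp: mem)
      then consider "{a. pt a \<in> \<alpha>} = {}" | "{a. pt a \<in> \<alpha>} = {Some i}" by blast
      then show ?thesis
      proof cases
        case 1
        show ?thesis unfolding 1 using zero by simp
      next
        case 2
        show ?thesis unfolding 2 using vert[of i] w(1)[of i]
          by (auto simp: cone_of_def m_def pt_def)
      qed
    qed
  qed
  moreover have "(\<Sum>a\<in>UNIV. m a *\<^sub>R pt a) = 1 - w"
    using mean[of "{}", unfolded U] by (simp add: vec_eq_iff)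
  ultimately show ?thesis by simp
qed

section \<open>Points that survive conditioning\<close>

text \<open>
  The last condition says that after conditioning on at most \<open>k\<close> coordinates being one, the
  mean still lies in the cropped cube. It is multiplied out by the probability of the condition,
  so that it makes sense when that probability is zero.
\<close>
definition robust :: "real \<Rightarrow> nat \<Rightarrow> real ^ 'n \<Rightarrow> bool" where
  "robust \<rho> k w \<longleftrightarrow> (\<forall>i. 0 \<le> w $ i) \<and> (\<Sum>i\<in>UNIV. w $ i) \<le> 1 \<and>
     (\<forall>S. card S \<le> k \<longrightarrow> \<rho> * (1 - (\<Sum>i\<in>S. w $ i)) \<le> (\<Sum>i\<in>-S. w $ i))"

lemma sum_Compl:
  fixes f :: "'n::finite \<Rightarrow> real"
  shows "sum f (- S) = sum f UNIV - sum f S"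
  by (simp add: Compl_eq_Diff_UNIV sum_diff)

lemma robust_axis: "\<rho> \<le> 1 \<Longrightarrow> robust \<rho> k (axis i 1)"
  by (auto simp: robust_def axis_def sum_Compl)

text \<open>
  Conditioning on \<open>S\<close> and then on \<open>T\<close> is conditioning on \<open>S \<union> T\<close>. This is what lets the
  iterated operator spend one level of robustness per application.
\<close>
lemma robust_condition_on:
  assumes w: "robust \<rho> (l + k) w" and S: "card S \<le> l" and lt: "(\<Sum>i\<in>S. w $ i) < 1"
  shows "robust \<rho> k (condition_on S w)"
  unfolding robust_def
proof (intro conjI allI impI)
  define r where "r = 1 - (\<Sum>i\<in>S. w $ i)"
  have r: "r > 0" using lt by (simp add: r_def)
  have sum_cond: "(\<Sum>i\<in>R. condition_on S w $ i) = (\<Sum>i\<in>R - S. w $ i) / r" for R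
    unfolding condition_on_def r_def[symmetric] sum_divide_distrib
    by (rule sum.mono_neutral_cong_right) auto
  show "0 \<le> condition_on S w $ i" for i
    using w r by (simp add: condition_on_def r_def robust_def)
  have "(\<Sum>i\<in>UNIV - S. w $ i) \<le> r"
    using w sum_Compl[of "($) w" S] by (simp add: r_def robust_def Compl_eq_Diff_UNIV)
  then show "(\<Sum>i\<in>UNIV. condition_on S w $ i) \<le> 1"
    unfolding sum_cond using r by simp
  fix T :: "'a set" assume T: "card T \<le> k"
  have "card (S \<union> T) \<le> l + k" using card_Un_le[of S T] S T by linarith
  then have "\<rho> * (1 - (\<Sum>i\<in>S \<union> T. w $ i)) \<le> (\<Sum>i\<in>- (S \<union> T). w $ i)"
    using w by (auto simp: robust_def)
  moreover have "(\<Sum>i\<in>S \<union> T. w $ i) = (\<Sum>i\<in>S. w $ i) + (\<Sum>i\<in>T - S. w $ i)"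
    using sum.union_disjoint[of S "T - S" "($) w"] by simp
  moreover have "- (S \<union> T) = - T - S" by auto
  ultimately have "\<rho> * (r - (\<Sum>i\<in>T - S. w $ i)) \<le> (\<Sum>i\<in>- T - S. w $ i)"
    by (simp add: r_def algebra_simps)
  then have "\<rho> * (r - (\<Sum>i\<in>T - S. w $ i)) / r \<le> (\<Sum>i\<in>- T - S. w $ i) / r"
    using r by (intro divide_right_mono) auto
  moreover have "\<rho> * (1 - (\<Sum>i\<in>T - S. w $ i) / r) = \<rho> * (r - (\<Sum>i\<in>T - S. w $ i)) / r"
    using r by (simp add: field_simps)
  ultimately show "\<rho> * (1 - (\<Sum>i\<in>T. condition_on S w $ i)) \<le> (\<Sum>i\<in>- T. condition_on S w $ i)"
    unfolding sum_cond by simp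
qed

lemma robust_in_cropped_cube:
  assumes "robust \<rho> k w"
  shows "1 - w \<in> cropped_cube \<rho>"
proof -
  have "w $ i \<le> 1" for i
    using assms member_le_sum[of i UNIV "($) w"] by (force simp: robust_def)
  moreover have "\<rho> \<le> (\<Sum>i\<in>UNIV. w $ i)"
    using assms unfolding robust_def by (elim conjE allE[of _ "{}"]) auto
  ultimately show ?thesis
    using assms by (auto simp: cropped_cube_def robust_def sum_subtractf)
qed

lemma robust_in_SA_plus:
  assumes "\<rho> \<le> 1" and w: "robust \<rho> k w"
  shows "1 - w \<in> SA_plus k (cropped_cube \<rho>)"
proof (rule SA_plus_near_one)
  show "1 - axis i 1 \<in> cropped_cube \<rho>" for i
    using assms(1) by (intro robust_in_cropped_cube[of _ 0] robust_axis)
  show "1 - condition_on S w \<in> cropped_cube \<rho>" if "card S \<le> k" "(\<Sum>i\<in>S. w $ i) < 1" for S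
    using that w by (intro robust_in_cropped_cube[of _ 0] robust_condition_on[of _ k]) auto
qed (use w in \<open>auto simp: robust_def\<close>)

lemma robust_in_LS_plus:
  fixes w :: "real ^ 'n"
  assumes "\<rho> \<le> 1" and w: "robust \<rho> k w"
  shows "1 - w \<in> LS_plus k (cropped_cube \<rho>)"
  using w
proof (induction k arbitrary: w)
  case 0
  then show ?case by (simp add: LS_plus_def robust_in_cropped_cube)
next
  case (Suc k)
  have "1 - w \<in> SA_plus 1 (LS_plus k (cropped_cube \<rho>))"
  proof (rule SA_plus_near_one)
    show "1 - axis i 1 \<in> LS_plus k (cropped_cube \<rho>)" for i :: 'n
      using assms(1) by (intro Suc.IH robust_axis)
    show "1 - condition_on S w \<in> LS_plus k (cropped_cube \<rho>)"
      if "card S \<le> 1" "(\<Sum>i\<in>S. w $ i) < 1" for S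
      using that Suc.prems by (intro Suc.IH robust_condition_on[of _ 1]) auto
  qed (use Suc.prems in \<open>auto simp: robust_def\<close>)
  then show ?case by (simp add: LS_plus_def)
qed

section \<open>The common optimal point\<close>

definition optimum :: "real \<Rightarrow> nat \<Rightarrow> real ^ 'n" where
  "optimum \<rho> k = (\<chi> i. 1 - \<rho> / (real CARD('n) - real k + real k * \<rho>))"

lemma denominator_pos:
  assumes "0 < \<rho>" "k \<le> n" "0 < n"
  shows "0 < real n - real k + real k * \<rho>"
proof (cases "k = n")
  case False
  then have "0 < real n - real k" "0 \<le> real k * \<rho>" using assms by auto
  then show ?thesis by linarith
qed (use assms in simp)

text \<open>
  With \<open>q = \<rho>/D\<close> and \<open>s = card S\<close>, robustness asks for \<open>\<rho> (1 - s q) \<le> (n - s) q\<close>, that is,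
  \<open>D - s\<rho> \<le> n - s\<close>, with equality at \<open>s = k\<close>.
\<close>
lemma robust_optimum:
  assumes \<rho>: "0 < \<rho>" "\<rho> < 1" and k: "k \<le> CARD('n)"
  shows "robust \<rho> k (1 - optimum \<rho> k :: real ^ 'n)"
proof -
  define D where "D = real CARD('n) - real k + real k * \<rho>"
  have D: "D > 0" unfolding D_def using assms by (intro denominator_pos) auto
  have w: "(1 - optimum \<rho> k :: real ^ 'n) $ i = \<rho> / D" for i by (simp add: optimum_def D_def)
  have "real CARD('n) * \<rho> \<le> D"
  proof -
    have "0 \<le> (real CARD('n) - real k) * (1 - \<rho>)" using assms by simp
    then show ?thesis by (simp add: D_def algebra_simps)
  qed
  then have sum: "real CARD('n) * (\<rho> / D) \<le> 1" using D by simp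
  have "\<rho> * (1 - real (card S) * (\<rho> / D)) \<le> (real CARD('n) - real (card S)) * (\<rho> / D)"
    if "card S \<le> k" for S :: "'n set"
  proof -
    have "0 \<le> (1 - \<rho>) * (real k - real (card S))" using that \<rho> by simp
    then have "D - real (card S) * \<rho> \<le> real CARD('n) - real (card S)"
      by (simp add: D_def algebra_simps)
    then have "\<rho> * (D - real (card S) * \<rho>) / D \<le> \<rho> * (real CARD('n) - real (card S)) / D"
      using D \<rho> by (intro divide_right_mono mult_left_mono) auto
    moreover have "\<rho> * (1 - real (card S) * (\<rho> / D)) = \<rho> * (D - real (card S) * \<rho>) / D"
      using D by (simp add: field_simps)
    ultimately show ?thesis by (simp add: mult.commute)
  qed
  moreover have "real (card (- S)) = real CARD('n) - real (card S)" for S :: "'n set"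
    using sum_Compl[of "\<lambda>_. 1" S] by simp
  ultimately show ?thesis
    using D \<rho> sum unfolding robust_def w by simp
qed

text \<open>
  For a given \<open>S\<close> the point is a convex combination of \<open>n\<close> points that each differ from
  \<open>1\<close> in one coordinate \<open>i\<close>: by a full unit for \<open>i \<in> S\<close>, where the coordinate must be
  integral, and by only \<open>\<rho>\<close> for \<open>i \<notin> S\<close>. Matching every coordinate forces the weights
  \<open>q\<close> and \<open>q/\<rho>\<close>, where \<open>q = \<rho>/D\<close>, and these add up to \<open>kq + (n - k) q/\<rho> = 1\<close>.
\<close>
lemma optimum_in_LS_tilde:
  assumes \<rho>: "0 < \<rho>" "\<rho> < 1" and k: "k \<le> CARD('n)"
  shows "(optimum \<rho> k :: real ^ 'n) \<in> LS_tilde k (cropped_cube \<rho>)"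
proof -
  define D where "D = real CARD('n) - real k + real k * \<rho>"
  have D: "D > 0" unfolding D_def using assms by (intro denominator_pos) auto
  have hull: "optimum \<rho> k \<in> convex hull {x \<in> cropped_cube \<rho>. \<forall>i\<in>S. x $ i \<in> {0, 1}}"
    if S: "card S = k" for S :: "'n set"
  proof -
    define c where "c i = (if i \<in> S then 1 else \<rho>)" for i
    define p :: "'n \<Rightarrow> real ^ 'n" where "p i = 1 - axis i (c i)" for i
    define u where "u i = (\<rho> / D) / c i" for i
    have c: "0 < c i" "\<rho> \<le> c i" "c i \<le> 1" for i using \<rho> by (auto simp: c_def)
    have u0: "0 \<le> u i" for i using c[of i] D \<rho> by (simp add: u_def)
    have "sum u UNIV = (\<Sum>i\<in>UNIV. 1 / D - (if i \<in> S then (1 - \<rho>) / D else 0))"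
      using D \<rho> by (intro sum.cong) (auto simp: u_def c_def field_simps)
    also have "\<dots> = (CARD('n) - k * (1 - \<rho>)) / D"
      by (simp add: sum_subtractf sum.If_cases S diff_divide_distrib add_divide_distrib algebra_simps)
    also have "\<dots> = 1" using D by (simp add: D_def algebra_simps)
    finally have u1: "sum u UNIV = 1" .
    have "p i \<in> convex hull {x \<in> cropped_cube \<rho>. \<forall>i\<in>S. x $ i \<in> {0, 1}}" for i
    proof (rule hull_inc, intro CollectI conjI ballI)
      show "p i \<in> cropped_cube \<rho>"
        using c[of i] by (auto simp: p_def axis_def cropped_cube_def sum_subtractf)
      show "p i $ j \<in> {0, 1}" if "j \<in> S" for j using that by (auto simp: p_def axis_def c_def)
    qed
    then have "(\<Sum>i\<in>UNIV. u i *\<^sub>R p i) \<in> convex hull {x \<in> cropped_cube \<rho>. \<forall>i\<in>S. x $ i \<in> {0, 1}}"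
      using u0 u1 by (intro convex_sum) auto
    moreover have "(\<Sum>i\<in>UNIV. u i *\<^sub>R p i) = optimum \<rho> k"
    proof (rule vec_eq_iff[THEN iffD2], rule allI)
      fix j
      have "(\<Sum>i\<in>UNIV. u i *\<^sub>R p i) $ j = (\<Sum>i\<in>UNIV. u i - (if i = j then u i * c i else 0))"
        by (auto simp: p_def axis_def algebra_simps intro!: sum.cong)
      also have "\<dots> = 1 - \<rho> / D"
        unfolding sum_subtractf u1 using c[of j] by (simp add: u_def)
      finally show "(\<Sum>i\<in>UNIV. u i *\<^sub>R p i) $ j = optimum \<rho> k $ j"
        by (simp add: optimum_def D_def)
    qed
    ultimately show ?thesis by simp
  qed
  show ?thesis
  proof (cases "k = 0")
    case True
    then show ?thesis
      using robust_in_cropped_cube[OF robust_optimum[OF assms]] by (simp add: LS_tilde_def)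
  qed (use hull in \<open>auto simp: LS_tilde_def\<close>)
qed

section \<open>The integrality gap\<close>

lemma max_over_eqI: "x \<in> P \<Longrightarrow> c \<bullet> x = m \<Longrightarrow> (\<And>y. y \<in> P \<Longrightarrow> c \<bullet> y \<le> m) \<Longrightarrow> max_over c P = m"
  unfolding max_over_def by (rule Greatest_equality) auto

lemma inner_ones: "(\<chi> i. 1) \<bullet> (x :: real ^ 'n) = (\<Sum>i\<in>UNIV. x $ i)"
  by (simp add: inner_vec_def)

text \<open>
  Relaxing does not change the integer hull, and for the maximum over the integer hull it is
  enough that the vertex \<open>1\<close> is cut off while its neighbours in the cube are kept.
\<close>
lemma max_over_integer_hull:
  fixes R :: "(real ^ 'n) set"
  assumes \<rho>: "0 < \<rho>" and cut: "R \<subseteq> cut \<rho> S" and vert: "\<And>i. 1 - axis i 1 \<in> R"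
  shows "max_over (\<chi> i. 1) (integer_hull R) = real CARD('n) - 1"
proof (rule max_over_eqI)
  fix j :: 'n
  have "1 - axis j 1 \<in> R \<inter> cube"
    using vert by (auto simp: cube_def axis_def)
  then show "1 - axis j 1 \<in> integer_hull R"
    unfolding integer_hull_def by (rule hull_inc)
  show "(\<chi> i. 1) \<bullet> (1 - axis j 1 :: real ^ 'n) = real CARD('n) - 1"
    unfolding inner_ones by (simp add: axis_def sum_subtractf)
next
  fix y :: "real ^ 'n" assume y: "y \<in> integer_hull R"
  have "R \<inter> cube \<subseteq> {x. (\<chi> i. 1) \<bullet> x \<le> real CARD('n) - 1}"
  proof
    fix x :: "real ^ 'n" assume x: "x \<in> R \<inter> cube"
    then have x01: "x $ i = 0 \<or> x $ i = 1" for i by (auto simp: cube_def)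
    have "x \<in> cut \<rho> S" using x cut by blast
    have "\<not> (\<forall>j. x $ j = 1)"
    proof
      assume "\<forall>j. x $ j = 1"
      then show False using \<open>x \<in> cut \<rho> S\<close> \<rho> by (simp add: cut_def)
    qed
    then obtain j where j: "x $ j = 0" using x01 by blast
    have "1 - x $ j \<le> (\<Sum>i\<in>UNIV. 1 - x $ i)"
    proof (rule member_le_sum)
      show "0 \<le> 1 - x $ i" for i using x01[of i] by auto
    qed auto
    then show "x \<in> {x. (\<chi> i. 1) \<bullet> x \<le> real CARD('n) - 1}"
      using j by (simp add: inner_ones sum_subtractf)
  qed
  then have "integer_hull R \<subseteq> {x. (\<chi> i. 1) \<bullet> x \<le> real CARD('n) - 1}"
    unfolding integer_hull_def by (intro hull_minimal convex_halfspace_le)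
  then show "(\<chi> i. 1) \<bullet> y \<le> real CARD('n) - 1" using y by auto
qed

theorem theorem15:
  fixes \<rho> :: real
    and \<Gamma> :: "nat \<Rightarrow> (real ^ 'n) set \<Rightarrow> (real ^ 'n) set"
    and n k :: nat
  assumes "n = CARD('n)" and "n \<ge> 2"
    and "0 < \<rho>" and "\<rho> < 1"
    and "\<Gamma> \<in> {LS_tilde, LS_plus, SA, SA_plus}"
    and "k \<le> n"
  shows "integrality_gap (\<chi> i. 1) (\<Gamma> k (cropped_cube \<rho>))
    = 1 + (real n - real k) * (1 - \<rho>)
          / ((real n - 1) * (real n - real k + real k * \<rho>))"
proof -
  define D where "D = real n - real k + real k * \<rho>"
  have D: "0 < D"
    using assms unfolding D_def by (intro denominator_pos) auto
  have k: "k \<le> CARD('n)" using assms by simp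
  have SA_cut': "SA k (cropped_cube \<rho>) \<subseteq> cut \<rho> S" if "card S = k" for S :: "'n set"
  proof (cases "k = 0")
    case True
    then show ?thesis
      using that cropped_cube_subset_cut by (simp add: SA_def)
  next
    case False
    then show ?thesis
      using SA_cut[of \<rho> "cropped_cube \<rho>" "{}" S k] cropped_cube_subset_cut assms that
      by (auto simp: cropped_cube_def)
  qed
  have cuts: "\<Gamma> k (cropped_cube \<rho>) \<subseteq> cut \<rho> S" if "card S = k" for S
    using assms(3,5) that SA_cut'[OF that] LS_plus_cut[of \<rho> S] LS_tilde_cut[of \<rho> S]
      SA_plus_subset_SA[of k "cropped_cube \<rho>"]
    by auto
  have "optimum \<rho> k \<in> SA_plus k (cropped_cube \<rho> :: (real ^ 'n) set)"
    "optimum \<rho> k \<in> LS_plus k (cropped_cube \<rho> :: (real ^ 'n) set)"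
    using robust_in_SA_plus[OF _ robust_optimum[OF assms(3,4) k]]
      robust_in_LS_plus[OF _ robust_optimum[OF assms(3,4) k]] assms(4) by simp_all
  then have feasible: "optimum \<rho> k \<in> \<Gamma> k (cropped_cube \<rho>)"
    using assms(5) optimum_in_LS_tilde[OF assms(3,4) k] SA_plus_subset_SA by blast
  have neighbour: "1 - axis i 1 \<in> \<Gamma> k (cropped_cube \<rho>)" for i
  proof -
    have robust: "robust \<rho> l (axis i 1)" for l using assms(4) by (simp add: robust_axis)
    then have "1 - axis i 1 \<in> SA_plus k (cropped_cube \<rho>)"
      "1 - axis i 1 \<in> LS_plus k (cropped_cube \<rho>)"
      using assms(4) by (auto intro: robust_in_SA_plus robust_in_LS_plus)
    moreover have "1 - axis i 1 \<in> LS_tilde k (cropped_cube \<rho>)"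
      using robust_in_cropped_cube[OF robust]
      by (simp add: LS_tilde_def) (auto simp: axis_def intro!: hull_inc split: if_splits)
    ultimately show ?thesis using assms(5) SA_plus_subset_SA by blast
  qed
  have "max_over (\<chi> i. 1) (\<Gamma> k (cropped_cube \<rho>)) = real n - real n * \<rho> / D"
  proof (rule max_over_eqI[OF feasible])
    show "(\<chi> i. 1) \<bullet> (optimum \<rho> k :: real ^ 'n) = real n - real n * \<rho> / D"
      using assms(1) by (simp add: inner_ones optimum_def D_def right_diff_distrib)
    show "(\<chi> i. 1) \<bullet> y \<le> real n - real n * \<rho> / D" if "y \<in> \<Gamma> k (cropped_cube \<rho>)" for y
      using sum_le_of_cuts[of \<rho> k y] cuts that assms k D by (auto simp: inner_ones D_def)
  qed
  moreover have "max_over (\<chi> i. 1) (integer_hull (\<Gamma> k (cropped_cube \<rho>))) = real n - 1"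
  proof -
    obtain S :: "'n set" where S: "card S = k"
      using k by (meson finite_UNIV obtain_subset_with_card_n)
    show ?thesis
      unfolding assms(1) using assms(3) cuts[OF S] neighbour by (rule max_over_integer_hull)
  qed
  moreover have "(real n - real n * \<rho> / D) / (real n - 1)
      = 1 + (real n - real k) * (1 - \<rho>) / ((real n - 1) * D)"
  proof -
    have "(real n - real n * \<rho> / D) * D = real n * D - real n * \<rho>"
      using D by (simp add: left_diff_distrib)
    also have "\<dots> = (real n - 1) * D + (real n - real k) * (1 - \<rho>)"
      by (simp add: D_def algebra_simps)
    finally have "(real n - real n * \<rho> / D) * D = (real n - 1) * D + (real n - real k) * (1 - \<rho>)" .
    then show ?thesis using D assms(2) by (simp add: field_simps)
  qed
  ultimately show ?thesis by (simp add: integrality_gap_def D_def)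
qed

end
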